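(* Let $u\in C_{+,\log}$. Then the Legendre transform $\ell_u$ of $u$ is log-concave on $[0,\infty)$. (Hence the function $t\mapsto \ell_u(t)$ is continuous on $[0,\infty)$ and the sequence $\{\ell_u(n)\}_{n=0}^\infty$ is log-concave, i.e. $\ell_u(n)\,\ell_u(n+2)\le \ell_u(n+1)^2$ for all integers $n\ge 0$.)
   Context: $C_{+,\log}$ denotes the set of all positive continuous functions $u:[0,\infty)\to(0,\infty)$ with $\lim_{r\to\infty}\frac{\log u(r)}{\log r}=\infty$. For $u\in C_{+,\log}$ the Legendre transform is $\ell_u(t)=\inf_{r>0}\frac{u(r)}{r^t}$, $t\in[0,\infty)$. A positive function $f$ on $[0,\infty)$ is log-concave if $\log f$ is concave, i.e. $f(\lambda t_1+(1-\lambda)t_2)\ge f(t_1)^\lambda f(t_2)^{1-\lambda}$ for all $t_1,t_2\ge 0$ and $0\le\lambda\le1$. *)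

theory Defs
  imports "HOL-Analysis.Analysis"
begin

text \<open>Functions on \<open>[0,\<infinity>)\<close> are total functions \<open>real \<Rightarrow> real\<close> of which only the values on \<open>{0..}\<close> matter.\<close>

definition C_plus_log :: "(real \<Rightarrow> real) set" where
  "C_plus_log = {u. continuous_on {0..} u \<and> (\<forall>r\<ge>0. u r > 0) \<and>
                    filterlim (\<lambda>r. ln (u r) / ln r) at_top at_top}"

text \<open>For \<open>u\<close> positive on \<open>(0,\<infinity>)\<close> the set of quotients is nonempty and bounded below by \<open>0\<close>,
  so this conditionally complete infimum is the genuine one.\<close>

definition legendre_transform :: "(real \<Rightarrow> real) \<Rightarrow> real \<Rightarrow> real" where
  "legendre_transform u t = (INF r\<in>{0<..}. u r / r powr t)"

definition log_concave_on :: "real set \<Rightarrow> (real \<Rightarrow> real) \<Rightarrow> bool" where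
  "log_concave_on S f \<longleftrightarrow> (\<forall>t\<in>S. f t > 0) \<and> concave_on S (\<lambda>t. ln (f t))"

end

theory Submission
  imports Defs
begin

text \<open>
  For each fixed \<open>r > 0\<close> the function \<open>t \<mapsto> ln (u r / r\<^sup>t) = ln (u r) - t * ln r\<close> is affine, so
  \<open>ln \<circ> \<ell>\<close>, where \<open>\<ell>\<close> is the Legendre transform of \<open>u\<close>, is an infimum of affine functions and
  therefore concave.  This makes sense only once \<open>\<ell> t > 0\<close>
  (\<open>legendre_transform_pos\<close>), and that is where the hypotheses on \<open>u\<close> enter: the growth condition
  gives \<open>u r / r\<^sup>t \<ge> 1\<close> beyond some \<open>R\<close>, and compactness bounds \<open>u\<close> away from \<open>0\<close> on \<open>[0,R]\<close>.

  Concavity gives continuity in the interior \<open>(0,\<infinity>)\<close>, but a concave function may jump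
  down at an end point of its domain.  At \<open>0\<close> the jump is excluded because an infimum of
  continuous functions is upper semicontinuous (\<open>continuous_within_zero_concave\<close>).  The
  inequality for the sequence is midpoint concavity between \<open>n\<close> and \<open>n + 2\<close>.
\<close>

text \<open>The upper semicontinuity hypothesis rules out a downward jump at the end point; an upward
  one is excluded by concavity, since \<open>f\<close> lies above its chord over \<open>[0,1]\<close>.\<close>

lemma continuous_within_zero_concave:
  fixes f :: "real \<Rightarrow> real"
  assumes conc: "concave_on {0..} f"
    and usc: "\<And>a. f 0 < a \<Longrightarrow> eventually (\<lambda>t. f t < a) (at 0 within {0..})"
  shows "continuous (at 0 within {0..}) f"
proof -
  have "eventually (\<lambda>t. a < f t) (at 0 within {0..})" if "a < f 0" for a
  proof -
    have chord: "(1 - t) * f 0 + t * f 1 \<le> f t" if "t \<in> {0..1}" for t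
      using concave_onD[OF conc, of t 0 1] that by simp
    have "((\<lambda>t. (1 - t) * f 0 + t * f 1) \<longlongrightarrow> (1 - 0) * f 0 + 0 * f 1) (at 0 within {0..})"
      by (intro tendsto_intros)
    with that have "eventually (\<lambda>t. a < (1 - t) * f 0 + t * f 1) (at 0 within {0..})"
      by (intro order_tendstoD) auto
    moreover have "eventually (\<lambda>t::real. t < 1) (at 0 within {0..})"
      by (rule order_tendstoD[OF tendsto_ident_at]) simp
    moreover have "eventually (\<lambda>t::real. t \<ge> 0) (at 0 within {0..})"
      by (auto simp: eventually_at_filter)
    ultimately show ?thesis
      by eventually_elim (use chord in force)
  qed
  with usc show ?thesis
    unfolding continuous_within by (intro order_tendstoI)
qed

lemma C_plus_log_pos: "u r > 0" if "u \<in> C_plus_log" "r \<ge> 0"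
  using that by (simp add: C_plus_log_def)

lemma legendre_transform_le:
  assumes "u \<in> C_plus_log" "r > 0"
  shows "legendre_transform u t \<le> u r / r powr t"
  unfolding legendre_transform_def
proof (rule cINF_lower)
  show "bdd_below ((\<lambda>r. u r / r powr t) ` {0<..})"
    using C_plus_log_pos[OF assms(1)] by (intro bdd_belowI2[of _ 0]) (simp add: less_imp_le)
qed (use assms in simp)

text \<open>Continuity of \<open>u\<close> up to and including \<open>0\<close> supplies the compactness near \<open>r = 0\<close>, where
  \<open>t \<ge> 0\<close> makes the factor \<open>1 / r\<^sup>t\<close> harmless.\<close>

lemma legendre_transform_pos:
  assumes u: "u \<in> C_plus_log" and t: "t \<ge> 0"
  shows "legendre_transform u t > 0"
proof -
  have "eventually (\<lambda>r. t \<le> ln (u r) / ln r) at_top"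
    using u by (auto simp: C_plus_log_def filterlim_at_top)
  then obtain R0 where R0: "\<And>r. r \<ge> R0 \<Longrightarrow> t \<le> ln (u r) / ln r"
    by (auto simp: eventually_at_top_linorder)
  \<comment> \<open>Taking \<open>R > 1\<close> makes \<open>ln r\<close> positive beyond \<open>R\<close>, so the quotient bound can be multiplied out.\<close>
  define R where "R = max R0 2"
  have large: "1 \<le> u r / r powr t" if "r \<ge> R" for r
  proof -
    have r: "r > 1" "r \<ge> R0" using that by (auto simp: R_def)
    hence "t * ln r \<le> ln (u r)"
      using R0[of r] by (simp add: pos_le_divide_eq)
    hence "exp (t * ln r) \<le> exp (ln (u r))" by simp
    thus ?thesis
      using r C_plus_log_pos[OF u, of r] by (simp add: powr_def)
  qed
  have "continuous_on {0..R} u"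
    using u by (auto simp: C_plus_log_def intro: continuous_on_subset)
  then obtain s where s: "s \<in> {0..R}" "\<And>r. r \<in> {0..R} \<Longrightarrow> u s \<le> u r"
    using continuous_attains_inf[of "{0..R}" u] by (force simp: R_def le_max_iff_disj)
  have us: "u s > 0" using s(1) C_plus_log_pos[OF u] by simp
  have small: "u s / R powr t \<le> u r / r powr t" if "0 < r" "r \<le> R" for r
    using that s(2)[of r] us t by (intro frac_le powr_mono2) auto
  have "min 1 (u s / R powr t) \<le> legendre_transform u t"
    unfolding legendre_transform_def
  proof (rule cINF_greatest)
    fix r :: real assume "r \<in> {0<..}"
    thus "min 1 (u s / R powr t) \<le> u r / r powr t"
      using large[of r] small[of r] by (cases "r \<le> R") (auto simp: min_le_iff_disj)
  qed auto
  moreover have "min 1 (u s / R powr t) > 0"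
    using us by (simp add: R_def)
  ultimately show ?thesis by linarith
qed

lemma ln_legendre_transform_le:
  assumes u: "u \<in> C_plus_log" and "t \<ge> 0" "r > 0"
  shows "ln (legendre_transform u t) \<le> ln (u r) - t * ln r"
proof -
  have "ln (legendre_transform u t) \<le> ln (u r / r powr t)"
    using legendre_transform_le[OF u \<open>r > 0\<close>] legendre_transform_pos[OF u \<open>t \<ge> 0\<close>]
    by (rule ln_mono)
  also have "\<dots> = ln (u r) - t * ln r"
    using C_plus_log_pos[OF u, of r] \<open>r > 0\<close> by (simp add: ln_div ln_powr)
  finally show ?thesis .
qed

text \<open>Together with \<open>ln_legendre_transform_le\<close> this says that \<open>ln \<circ> \<ell>\<close> is the
  infimum of the affine functions \<open>t \<mapsto> ln (u r) - t * ln r\<close>.\<close>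

lemma ln_legendre_transform_greatest:
  assumes u: "u \<in> C_plus_log" and t: "t \<ge> 0"
    and le: "\<And>r. r > 0 \<Longrightarrow> c \<le> ln (u r) - t * ln r"
  shows "c \<le> ln (legendre_transform u t)"
proof -
  have "exp c \<le> legendre_transform u t"
    unfolding legendre_transform_def
  proof (rule cINF_greatest)
    fix r :: real assume "r \<in> {0<..}"
    hence r: "r > 0" by simp
    have "exp c \<le> exp (ln (u r) - t * ln r)" using le[OF r] by simp
    also have "\<dots> = u r / r powr t"
      using r C_plus_log_pos[OF u, of r] by (simp add: exp_diff powr_def)
    finally show "exp c \<le> u r / r powr t" .
  qed auto
  thus ?thesis
    using legendre_transform_pos[OF u t] by (simp add: ln_ge_iff)
qed

lemma concave_on_ln_legendre_transform:
  assumes u: "u \<in> C_plus_log"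
  shows "concave_on {0..} (\<lambda>t. ln (legendre_transform u t))"
  unfolding concave_on_iff
proof (intro conjI ballI allI impI)
  fix x y a b :: real
  assume xy: "x \<in> {0..}" "y \<in> {0..}" and ab: "0 \<le> a" "0 \<le> b" "a + b = 1"
  have "a * ln (legendre_transform u x) + b * ln (legendre_transform u y)
      \<le> ln (u r) - (a * x + b * y) * ln r" if "r > 0" for r
  proof -
    have "a * ln (legendre_transform u x) + b * ln (legendre_transform u y)
        \<le> a * (ln (u r) - x * ln r) + b * (ln (u r) - y * ln r)"
      using xy ab that by (intro add_mono mult_left_mono ln_legendre_transform_le[OF u]) auto
    also have "\<dots> = (a + b) * ln (u r) - (a * x + b * y) * ln r"
      by (simp add: algebra_simps)
    finally show ?thesis using ab by simp
  qed
  thus "a * ln (legendre_transform u x) + b * ln (legendre_transform u y)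
      \<le> ln (legendre_transform u (a *\<^sub>R x + b *\<^sub>R y))"
    using xy ab by (intro ln_legendre_transform_greatest[OF u]) auto
qed auto

lemma continuous_on_ln_legendre_transform:
  assumes u: "u \<in> C_plus_log"
  shows "continuous_on {0..} (\<lambda>t. ln (legendre_transform u t))" (is "continuous_on _ ?L")
  unfolding continuous_on_eq_continuous_within
proof
  fix x :: real assume "x \<in> {0..}"
  then consider "x = 0" | "x > 0" by force
  thus "continuous (at x within {0..}) ?L"
  proof cases
    case 1
    have "eventually (\<lambda>t. ?L t < a) (at 0 within {0..})" if "?L 0 < a" for a
    proof -
      \<comment> \<open>By definition of the infimum, some affine function of the family is below \<open>a\<close> at \<open>0\<close>.\<close>
      obtain r where r: "r > 0" "ln (u r) - 0 * ln r < a"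
        using ln_legendre_transform_greatest[OF u, of 0 a] \<open>?L 0 < a\<close> by force
      have "((\<lambda>t. ln (u r) - t * ln r) \<longlongrightarrow> ln (u r) - 0 * ln r) (at 0 within {0..})"
        by (intro tendsto_intros)
      hence "eventually (\<lambda>t. ln (u r) - t * ln r < a) (at 0 within {0..})"
        using r(2) by (rule order_tendstoD)
      moreover have "eventually (\<lambda>t::real. t \<ge> 0) (at 0 within {0..})"
        by (auto simp: eventually_at_filter)
      ultimately show ?thesis
        by eventually_elim (use ln_legendre_transform_le[OF u _ r(1)] in force)
    qed
    thus ?thesis
      unfolding 1 by (rule continuous_within_zero_concave[OF concave_on_ln_legendre_transform[OF u]])
  next
    case 2
    have "convex_on {0<..} (\<lambda>t. - ?L t)"
      using concave_on_ln_legendre_transform[OF u] unfolding concave_on_def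
      by (rule convex_on_subset) auto
    hence "continuous_on {0<..} (\<lambda>t. - ?L t)"
      by (intro convex_on_continuous) auto
    hence "continuous_on {0<..} ?L"
      using continuous_on_minus by fastforce
    hence "isCont ?L x"
      using 2 by (simp add: continuous_on_eq_continuous_at)
    thus ?thesis by (rule continuous_at_imp_continuous_at_within)
  qed
qed

theorem theorem3p4:
  fixes u :: "real \<Rightarrow> real"
  assumes "u \<in> C_plus_log"
  shows "log_concave_on {0..} (legendre_transform u) \<and>
         continuous_on {0..} (legendre_transform u) \<and>
         (\<forall>n::nat. legendre_transform u (real n) * legendre_transform u (real (n + 2))
                     \<le> (legendre_transform u (real (n + 1)))\<^sup>2)"
proof (intro conjI allI)
  note pos = legendre_transform_pos[OF assms]
  note conc = concave_on_ln_legendre_transform[OF assms]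
  show "log_concave_on {0..} (legendre_transform u)"
    using pos conc by (simp add: log_concave_on_def)
  have "continuous_on {0..} (\<lambda>t. exp (ln (legendre_transform u t)))"
    by (intro continuous_on_exp continuous_on_ln_legendre_transform assms)
  thus "continuous_on {0..} (legendre_transform u)"
    by (rule continuous_on_eq) (use pos in simp)
  fix n :: nat
  let ?a = "legendre_transform u (real n)"
  let ?b = "legendre_transform u (real (n + 1))"
  let ?c = "legendre_transform u (real (n + 2))"
  have p: "?a > 0" "?b > 0" "?c > 0" by (auto intro!: pos)
  have mid: "(1 - 1/2) *\<^sub>R real n + (1/2) *\<^sub>R real (n + 2) = real (n + 1)"
    by (simp add: field_simps)
  have "(1 - 1/2) * ln ?a + 1/2 * ln ?c \<le> ln ?b"
    using concave_onD[OF conc, of "1/2" "real n" "real (n + 2)"] unfolding mid by simp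
  hence "ln (?a * ?c) \<le> ln (?b\<^sup>2)"
    using p by (simp add: ln_mult ln_realpow)
  thus "?a * ?c \<le> ?b\<^sup>2"
    using p by (subst (asm) ln_le_cancel_iff) auto
qed

end
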